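(* Suppose that for every non-decreasing sequence $\mathbf{d}$ generating a tree there exist positive integers $a,b$ such that $TErr(\mathbf{d})\le TErr(\mathbf{d}(a,b))$. Then for every non-decreasing sequence $\mathbf{d}$ generating a tree, $$TErr(\mathbf{d})\le\frac{3\sqrt2-4}{3\sqrt2+4}<0.03.$$
   Context: For a graph $G$, $W(G)$ is its set of pendent (degree-1) vertices, $RD(G)=(d_G(u,v))_{u,v\in W(G)}$ the terminal distance matrix, $TDSR(G)$ its largest eigenvalue, and $TWI(G)=\frac12\sum_{u,v\in W(G)}d_G(u,v)$. For a non-decreasing tree degree sequence $\mathbf{d}=(d_1\le\dots\le d_N)$, the BFS-tree $BFS(\mathbf{d})$ is built level by level: a root at level 1 with degree $d_N$ gets $d_N$ children at level 2, assigned from left to right degrees $d_{N-1},\dots,d_{N-d_N}$; inductively each vertex of level $\ell$ of assigned degree $\delta$ gets $\delta-1$ children at level $\ell+1$, ordered following their parents and assigned in order the largest unused entries, until all entries are used. If $\mathbf{d}$ has $n$ entries equal to 1, set $TUB(\mathbf{d})=TDSR(BFS(\mathbf{d}))$, $TLB(\mathbf{d})=\frac2n TWI(BFS(\mathbf{d}))$ and $TErr(\mathbf{d})=\frac{TUB(\mathbf{d})-TLB(\mathbf{d})}{TUB(\mathbf{d})}$. For positive integers $a,b$, $\mathbf{d}(a,b)=(\underbrace{1,\dots,1}_{a+b},\underbrace{2,\dots,2}_{a},a+b)$. *)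

theory Defs
  imports
    "Graph_Theory.Graph_Theory"
    "Jordan_Normal_Form.Spectral_Radius"
begin

text \<open>
  A finite simple undirected graph is a \<^locale>\<open>pair_graph\<close>: every undirected edge is present as
  two opposite arcs, so that the degree of a vertex is its out-degree.
\<close>

definition pendent_verts :: "'a pair_pre_digraph \<Rightarrow> 'a set" where
  "pendent_verts G = {v \<in> pverts G. out_degree G v = 1}"

definition graph_dist :: "'a pair_pre_digraph \<Rightarrow> 'a \<Rightarrow> 'a \<Rightarrow> real" where
  "graph_dist G u v = real_of_ereal (wf_digraph.\<mu> G (\<lambda>_. 1) u v)"

text \<open>
  Rows and columns are indexed by the pendent vertices in increasing order; the spectrum does not
  depend on the chosen order.
\<close>

definition terminal_dist_matrix :: "'a::linorder pair_pre_digraph \<Rightarrow> real mat" where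
  "terminal_dist_matrix G =
     (let ws = sorted_list_of_set (pendent_verts G); n = length ws
      in mat n n (\<lambda>(i, j). graph_dist G (ws ! i) (ws ! j)))"

definition TDSR :: "'a::linorder pair_pre_digraph \<Rightarrow> real" where
  "TDSR G = Max (spectrum (terminal_dist_matrix G))"

definition TWI :: "'a pair_pre_digraph \<Rightarrow> real" where
  "TWI G = 1/2 * (\<Sum>u\<in>pendent_verts G. \<Sum>v\<in>pendent_verts G. graph_dist G u v)"

text \<open>
  The constant \<^const>\<open>tree\<close> of the graph library cannot be used here: it forbids directed cycles,
  and the two arcs of an undirected edge form a directed cycle of length 2. The cycles of an
  undirected simple graph are the directed ones of length at least 3.
\<close>

definition undirected_tree :: "'a pair_pre_digraph \<Rightarrow> bool" where
  "undirected_tree G \<longleftrightarrow>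
     pair_graph G \<and> Digraph_Component.connected G \<and>
     \<not> (\<exists>p. pre_digraph.cycle G p \<and> length p \<ge> 3)"

text \<open>
  The one-vertex tree is left out: it has no pendent vertex, hence no largest eigenvalue of its
  terminal distance matrix.
\<close>

definition generates_tree :: "nat list \<Rightarrow> bool" where
  "generates_tree d \<longleftrightarrow>
     (\<exists>G :: nat pair_pre_digraph. undirected_tree G \<and> card (pverts G) \<ge> 2 \<and>
        mset d = image_mset (out_degree G) (mset_set (pverts G)))"

text \<open>
  \<open>bfs_arcs lev k ds\<close> is the set of all arcs (parent, child) below a given level. The list \<open>lev\<close>
  enumerates that level from left to right, each vertex paired with the number of its children;
  \<open>k\<close> is the first fresh vertex, and \<open>ds\<close> lists the unused degrees in non-increasing order. In one
  step, \<open>ps\<close> lists the parents of the vertices of the next level from left to right, \<open>as\<close> the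
  degrees assigned to these vertices, and \<open>cs\<close> the vertices themselves.
\<close>

function bfs_arcs :: "(nat \<times> nat) list \<Rightarrow> nat \<Rightarrow> nat list \<Rightarrow> (nat \<times> nat) set" where
  "bfs_arcs lev k ds =
     (let ps = concat (map (\<lambda>(v, c). replicate c v) lev);
          as = take (length ps) ds;
          cs = [k ..< k + length as]
      in if as = [] then {}
         else set (zip ps cs) \<union>
              bfs_arcs (zip cs (map (\<lambda>\<delta>. \<delta> - 1) as)) (k + length as) (drop (length ps) ds))"
  by pat_completeness auto
termination
  by (relation "measure (\<lambda>(lev, k, ds). length ds)") auto

declare bfs_arcs.simps [simp del]

definition BFS :: "nat list \<Rightarrow> nat pair_pre_digraph" where
  "BFS d =
     (let E = bfs_arcs [(0, last d)] 1 (rev (butlast d))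
      in \<lparr>pverts = {..<length d}, parcs = E \<union> E\<inverse>\<rparr>)"

definition TUB :: "nat list \<Rightarrow> real" where
  "TUB d = TDSR (BFS d)"

definition TLB :: "nat list \<Rightarrow> real" where
  "TLB d = 2 / real (count_list d 1) * TWI (BFS d)"

definition TErr :: "nat list \<Rightarrow> real" where
  "TErr d = (TUB d - TLB d) / TUB d"

definition dseq :: "nat \<Rightarrow> nat \<Rightarrow> nat list" where
  "dseq a b = replicate (a + b) 1 @ replicate a 2 @ [a + b]"

end

theory Submission
  imports Defs
begin

text \<open>
  \<open>BFS (dseq a b)\<close> is a spider with \<open>a\<close> legs of length 2 and \<open>b\<close> legs of length 1, so the distance
  of two distinct leaves is the sum of their heights. Put \<open>n = a + b\<close>. Then
  \<open>TLB = M\<close> with \<open>M = 2 (2 a + b) (n - 1) / n\<close>, and a positive eigenvalue of the terminal distance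
  matrix has an eigenvector that is constant on the leaves of equal height; hence it is a root of
  \<open>q x = (x + 4 - 4 a) (x + 2 - 2 b) - 9 a b\<close>.
  With \<open>c = (4 + 3 sqrt 2) / 8\<close> the claim is \<open>TUB \<le> c M\<close>, that is \<open>q (c M) \<ge> 0\<close>. From
  \<open>c\<^sup>2 = c + 1/32\<close> and \<open>c \<ge> 1\<close> this reduces to \<open>8 a b (n - 2)\<^sup>2 \<le> (n + a)\<^sup>2 (n - 1)\<^sup>2\<close>, which holds
  since \<open>(n + a)\<^sup>2 - 8 a b = (n - 3 a)\<^sup>2\<close>.
\<close>

section \<open>Distances certified by potentials\<close>

lemma (in wf_digraph) potential_le_awalk_cost:
  fixes f :: "'a \<Rightarrow> real"
  assumes "awalk u p v"
    and "\<And>e. e \<in> arcs G \<Longrightarrow> f (head G e) \<le> f (tail G e) + c e"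
  shows "f v - f u \<le> awalk_cost c p"
  using assms(1)
proof (induction p arbitrary: u)
  case Nil
  then show ?case by (simp add: awalk_Nil_iff)
next
  case (Cons e p)
  then have "e \<in> arcs G" "u = tail G e" "awalk (head G e) p v"
    by (simp_all add: awalk_Cons_iff)
  with Cons.IH[of "head G e"] assms(2)[of e] show ?case by simp
qed

text \<open>Weak duality for shortest walks: the arc inequalities telescope, so the potential
  difference bounds the cost of every walk from below, and a walk attaining it is optimal.\<close>

lemma (in wf_digraph) \<mu>_eq_potential_difference:
  fixes f :: "'a \<Rightarrow> real"
  assumes walk: "awalk u p v" "awalk_cost c p = f v - f u"
    and "\<And>e. e \<in> arcs G \<Longrightarrow> f (head G e) \<le> f (tail G e) + c e"
  shows "\<mu> c u v = ereal (f v - f u)"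
proof (rule antisym)
  show "\<mu> c u v \<le> ereal (f v - f u)"
    using min_cost_le_walk_cost[OF walk(1), of c] walk(2) by simp
  show "ereal (f v - f u) \<le> \<mu> c u v"
    unfolding \<mu>_def using potential_le_awalk_cost[OF _ assms(3)] by (intro INF_greatest) auto
qed

section \<open>The BFS tree of \<open>dseq a b\<close> and its leaves\<close>

lemma concat_replicate_zip_replicate_1:
  "length xs = m \<Longrightarrow>
     concat (map (\<lambda>(v, c). replicate c v) (zip xs (replicate m (Suc 0)))) = xs"
  by (induction xs arbitrary: m) auto

lemma concat_replicate_zip_replicate_0:
  "concat (map (\<lambda>(v, c). replicate c v) (zip xs (replicate m 0))) = []"
  by (auto dest: set_zip_rightD)

lemma set_zip_upt: "set (zip [i..<i + m] [j..<j + m]) = (\<lambda>l. (i + l, j + l)) ` {..<m}"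
  unfolding set_zip by force

lemma set_zip_replicate_upt: "set (zip (replicate m x) [j..<j + m]) = (\<lambda>l. (x, j + l)) ` {..<m}"
  unfolding set_zip by force

text \<open>Arcs point away from the centre 0. The numbering is the BFS order: 1 to \<open>a\<close>
  are the midpoints of the long legs, the next \<open>b\<close> vertices are the short leaves, the
  last \<open>a\<close> the long leaves.\<close>

definition spider_arcs :: "nat \<Rightarrow> nat \<Rightarrow> (nat \<times> nat) set" where
  "spider_arcs a b = {(0, i) | i. 1 \<le> i \<and> i \<le> a + b} \<union> {(i, a + b + i) | i. 1 \<le> i \<and> i \<le> a}"

lemma bfs_arcs_dseq:
  assumes "a > 0"
  shows "bfs_arcs [(0, a + b)] 1 (replicate a 2 @ replicate (a + b) 1) = spider_arcs a b"
proof -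
  let ?n = "a + b"
  have split: "[Suc 0..<Suc (a + b)] = [Suc 0..<Suc a] @ [Suc a..<Suc (a + b)]"
    using upt_add_eq_append[of "Suc 0" "Suc a" b] by simp
  have lev3: "bfs_arcs (zip cs (replicate m 0)) k ds = {}" for cs m k ds
    by (subst bfs_arcs.simps) (simp only: concat_replicate_zip_replicate_0 Let_def, simp)
  have ps: "concat (map (\<lambda>(v, c). replicate c v)
      (zip [Suc 0..<Suc (a + b)] (replicate a (Suc 0) @ replicate b 0))) = [Suc 0..<Suc a]"
    unfolding split
    by (simp add: concat_replicate_zip_replicate_0 concat_replicate_zip_replicate_1 del: upt_Suc concat_eq_Nil_conv)
  \<comment> \<open>Level 2 uses up all twos and \<open>b\<close> of the ones, so \<open>a\<close>
    ones remain for level 3, one below each midpoint.\<close>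
  have lev2: "bfs_arcs (zip [Suc 0..<Suc ?n] (replicate a (Suc 0) @ replicate b 0)) (Suc ?n)
      (replicate a 1) = (\<lambda>l. (1 + l, Suc ?n + l)) ` {..<a}"
    using assms set_zip_upt[of "Suc 0" a "Suc ?n"]
    by (subst bfs_arcs.simps) (simp add: ps Let_def lev3 del: upt_Suc)
  have "bfs_arcs [(0, a + b)] 1 (replicate a 2 @ replicate (a + b) 1) =
      (\<lambda>l. (0, 1 + l)) ` {..<?n} \<union> (\<lambda>l. (1 + l, Suc ?n + l)) ` {..<a}"
    using assms lev2 set_zip_replicate_upt[of ?n "0 :: nat" "Suc 0"]
    by (subst bfs_arcs.simps) (simp add: Let_def del: upt_Suc)
  also have "\<dots> = spider_arcs a b"
  proof -
    have "(0, i) \<in> (\<lambda>l. (0, 1 + l)) ` {..<?n}" if "1 \<le> i" "i \<le> a + b" for i :: nat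
      using that by (intro image_eqI[of _ _ "i - 1"]) auto
    moreover have "(i, ?n + i) \<in> (\<lambda>l. (1 + l, Suc ?n + l)) ` {..<a}" if "1 \<le> i" "i \<le> a" for i
      using that by (intro image_eqI[of _ _ "i - 1"]) auto
    ultimately show ?thesis unfolding spider_arcs_def by auto
  qed
  finally show ?thesis .
qed

lemma BFS_dseq:
  assumes "a > 0"
  shows "BFS (dseq a b) = \<lparr>pverts = {..2 * a + b}, parcs = spider_arcs a b \<union> (spider_arcs a b)\<inverse>\<rparr>"
proof -
  have "butlast (dseq a b) = replicate (a + b) 1 @ replicate a 2"
    by (simp add: dseq_def butlast_append)
  moreover have "length (dseq a b) = Suc (2 * a + b)" "last (dseq a b) = a + b"
    by (simp_all add: dseq_def)
  ultimately show ?thesis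
    using bfs_arcs_dseq[OF assms, of b] by (simp add: BFS_def Let_def lessThan_Suc_atMost)
qed

lemma pendent_verts_BFS_dseq:
  assumes "a > 0" "b > 0"
  shows "pendent_verts (BFS (dseq a b)) = {a + 1..2 * a + b}"
proof -
  let ?G = "BFS (dseq a b)"
  have out: "out_arcs ?G v = {e \<in> spider_arcs a b \<union> (spider_arcs a b)\<inverse>. fst e = v}" for v
    by (simp add: BFS_dseq[OF assms(1)] out_arcs_def)
  have "out_degree ?G v \<noteq> 1" if "v \<le> a" for v
  proof (cases "v = 0")
    case True
    \<comment> \<open>The centre has degree \<open>a + b\<close>, at least 2; two of its arcs
      suffice to rule out degree 1.\<close>
    have "{(0, 1), (0, 2)} \<subseteq> out_arcs ?G v" unfolding out using assms True
      by (auto simp: spider_arcs_def)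
    moreover have "out_arcs ?G v \<subseteq> {..2*a+b} \<times> {..2*a+b}" unfolding out
      by (auto simp: spider_arcs_def)
    then have "finite (out_arcs ?G v)" by (rule finite_subset) auto
    ultimately have "card {(0::nat, 1::nat), (0, 2)} \<le> out_degree ?G v"
      unfolding out_degree_def by (intro card_mono)
    then show ?thesis by simp
  next
    case False
    then have "out_arcs ?G v = {(v, 0), (v, a + b + v)}" unfolding out using that
      by (auto simp: spider_arcs_def)
    then show ?thesis using False by (simp add: out_degree_def)
  qed
  moreover have "out_degree ?G v = 1" if "a < v" "v \<le> 2 * a + b" for v
  proof (cases "v \<le> a + b")
    case True
    then have "out_arcs ?G v = {(v, 0)}" unfolding out using that
      by (auto simp: spider_arcs_def)
    then show ?thesis by (simp add: out_degree_def)
  next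
    case False
    then obtain i where i: "v = a + b + i" "1 \<le> i" "i \<le> a"
      using \<open>v \<le> 2 * a + b\<close> by (intro that[of "v - (a + b)"]) auto
    then have "out_arcs ?G v = {(v, i)}" unfolding out
      by (auto simp: spider_arcs_def)
    then show ?thesis by (simp add: out_degree_def)
  qed
  moreover have "pverts ?G = {..2 * a + b}" by (simp add: BFS_dseq[OF assms(1)])
  ultimately have "v \<in> pendent_verts ?G \<longleftrightarrow> v \<in> {a + 1..2 * a + b}" for v
    unfolding pendent_verts_def by (cases "v \<le> a") (auto simp: not_le)
  then show ?thesis by blast
qed

section \<open>Distances between the leaves of the spider\<close>

definition spider_height :: "nat \<Rightarrow> nat \<Rightarrow> real" where
  "spider_height n v = (if v = 0 then 0 else if v \<le> n then 1 else 2)"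

text \<open>A leg is labelled by its vertex next to the centre, and the centre itself by 0, where
  \<open>n\<close> stands for \<open>a + b\<close>.\<close>

definition spider_branch :: "nat \<Rightarrow> nat \<Rightarrow> nat" where
  "spider_branch n v = (if v \<le> n then v else v - n)"

lemma wf_BFS_dseq:
  assumes "a > 0"
  shows "wf_digraph (with_proj (BFS (dseq a b)))"
  by unfold_locales (auto simp: BFS_dseq[OF assms] spider_arcs_def)

lemma graph_dist_BFS_dseq:
  assumes "a > 0" and u: "u \<in> {a + 1..2 * a + b}" and v: "v \<in> {a + 1..2 * a + b}"
  shows "graph_dist (BFS (dseq a b)) u v =
    (if u = v then 0 else spider_height (a + b) u + spider_height (a + b) v)"
proof -
  let ?G = "BFS (dseq a b)" and ?n = "a + b"
  let ?h = "spider_height ?n" and ?br = "spider_branch ?n"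
  interpret wf_digraph "with_proj ?G" by (rule wf_BFS_dseq[OF assms(1)])
  \<comment> \<open>the signed height, negative on the leg of \<open>u\<close>, certifies the lower bound on the distance\<close>
  define f where "f w = (if ?br w = ?br u then - ?h w else ?h w)" for w
  have arcs: "parcs ?G = spider_arcs a b \<union> (spider_arcs a b)\<inverse>"
    and verts: "pverts ?G = {..2 * a + b}" by (simp_all add: BFS_dseq[OF assms(1)])
  \<comment> \<open>Heights change by 1 along each arc, and the sign can flip only at the centre,
    where the height is 0.\<close>
  have lipschitz: "f (snd e) \<le> f (fst e) + 1" if "e \<in> parcs ?G" for e
    using that assms(1) unfolding arcs
    by (auto simp: spider_arcs_def f_def spider_height_def spider_branch_def)
  have from_root: "\<exists>p. awalk 0 p w \<and> awalk_cost (\<lambda>_. 1) p = ?h w" if "w \<in> {a + 1..2 * a + b}" for w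
  proof (cases "w \<le> ?n")
    case True
    with that show ?thesis
      by (intro exI[of _ "[(0, w)]"])
        (auto simp: awalk_simps arcs verts spider_arcs_def spider_height_def)
  next
    case False
    with that show ?thesis
      by (intro exI[of _ "[(0, w - ?n), (w - ?n, w)]"])
        (auto simp: awalk_simps arcs verts spider_arcs_def spider_height_def)
  qed
  have to_root: "\<exists>p. awalk w p 0 \<and> awalk_cost (\<lambda>_. 1) p = ?h w" if "w \<in> {a + 1..2 * a + b}" for w
  proof (cases "w \<le> ?n")
    case True
    with that show ?thesis
      by (intro exI[of _ "[(w, 0)]"])
        (auto simp: awalk_simps arcs verts spider_arcs_def spider_height_def)
  next
    case False
    with that show ?thesis
      by (intro exI[of _ "[(w, w - ?n), (w - ?n, 0)]"])
        (auto simp: awalk_simps arcs verts spider_arcs_def spider_height_def)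
  qed
  show ?thesis
  proof (cases "u = v")
    case True
    then have "\<mu> (\<lambda>_. 1) u v = ereal (f v - f u)"
      using lipschitz u by (intro \<mu>_eq_potential_difference[of _ "[]"]) (auto simp: awalk_simps verts)
    then show ?thesis using True by (simp add: graph_dist_def)
  next
    case False
    \<comment> \<open>Each leg carries exactly one leaf.\<close>
    then have "?br v \<noteq> ?br u" using u v by (auto simp: spider_branch_def)
    then have f: "f v - f u = ?h u + ?h v" by (simp add: f_def)
    obtain p q where pq: "awalk u p 0" "awalk_cost (\<lambda>_. 1) p = ?h u"
        "awalk 0 q v" "awalk_cost (\<lambda>_. 1) q = ?h v"
      using to_root[OF u] from_root[OF v] by blast
    have "\<mu> (\<lambda>_. 1) u v = ereal (f v - f u)"
      using lipschitz pq f
      by (intro \<mu>_eq_potential_difference[of _ "p @ q"] awalk_appendI[of u p 0 q v]) auto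
    then show ?thesis using False f by (simp add: graph_dist_def)
  qed
qed

section \<open>Eigenvalues of the leaf distance matrix\<close>

definition height_mat :: "nat \<Rightarrow> (nat \<Rightarrow> real) \<Rightarrow> real mat" where
  "height_mat n h = mat n n (\<lambda>(i, j). if i = j then 0 else h i + h j)"

text \<open>The matrix has rank at most two up to its diagonal: completing the diagonal with
  \<open>2 * h i\<close> gives the entries \<open>h i + h j\<close>. So row \<open>i\<close> sees
  \<open>x\<close> only through two sums and \<open>x $ i\<close>.\<close>

lemma height_mat_mult_vec:
  assumes "x \<in> carrier_vec n" "i < n"
  shows "(height_mat n h *\<^sub>v x) $ i =
    h i * (\<Sum>j<n. x $ j) + (\<Sum>j<n. h j * x $ j) - 2 * h i * x $ i"
proof -
  have "(height_mat n h *\<^sub>v x) $ i = (\<Sum>j<n. (if i = j then 0 else h i + h j) * x $ j)"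
    using assms by (simp add: height_mat_def scalar_prod_def lessThan_atLeast0)
  also have "\<dots> = (\<Sum>j<n. (h i * x $ j + h j * x $ j) - (if i = j then 2 * h i * x $ i else 0))"
    by (intro sum.cong) (auto simp: algebra_simps)
  also have "\<dots> = h i * (\<Sum>j<n. x $ j) + (\<Sum>j<n. h j * x $ j) - 2 * h i * x $ i"
    using assms(2) by (simp add: sum_subtractf sum.distrib sum_distrib_left)
  finally show ?thesis .
qed

text \<open>Index \<open>i\<close> stands for the leaf \<open>a + 1 + i\<close>; in increasing order
  the \<open>b\<close> short leaves come first.\<close>

definition leaf_height :: "nat \<Rightarrow> nat \<Rightarrow> real" where
  "leaf_height b i = (if i < b then 1 else 2)"

lemma sum_leaf_split:
  fixes s p :: real
  shows "(\<Sum>i<a + b. if i < b then s else p) = real a * p + real b * s"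
proof -
  have "(\<Sum>i<a + b. if i < b then s else p) =
      (\<Sum>i\<in>{..<b}. if i < b then s else p) + (\<Sum>i\<in>{b..<b + a}. if i < b then s else p)"
    using sum.atLeastLessThan_concat[of 0 b "b + a" "\<lambda>i. if i < b then s else p"]
    by (simp add: lessThan_atLeast0 add.commute)
  also have "(\<Sum>i\<in>{..<b}. if i < b then s else p) = (\<Sum>i\<in>{..<b}. s)"
    by (intro sum.cong) auto
  also have "(\<Sum>i\<in>{b..<b + a}. if i < b then s else p) = (\<Sum>i\<in>{b..<b + a}. p)"
    by (intro sum.cong) auto
  finally show ?thesis by simp
qed

lemma leaf_sums:
  fixes x :: "real vec" and a b :: nat and s p :: real
  assumes "\<And>i. i < a + b \<Longrightarrow> x $ i = (if i < b then s else p)"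
  shows "(\<Sum>j<a + b. x $ j) = a * p + b * s"
    and "(\<Sum>j<a + b. leaf_height b j * x $ j) = 2 * a * p + b * s"
proof -
  have "(\<Sum>j<a + b. x $ j) = (\<Sum>j<a + b. if j < b then s else p)"
    using assms by (intro sum.cong) auto
  then show "(\<Sum>j<a + b. x $ j) = a * p + b * s" by (simp add: sum_leaf_split)
  have "(\<Sum>j<a + b. leaf_height b j * x $ j) = (\<Sum>j<a + b. if j < b then s else 2 * p)"
    using assms by (intro sum.cong) (auto simp: leaf_height_def)
  then show "(\<Sum>j<a + b. leaf_height b j * x $ j) = 2 * a * p + b * s" by (simp add: sum_leaf_split)
qed

lemma eigenvalue_height_mat_quadratic:
  fixes a b :: nat and k :: real
  assumes "eigenvalue (height_mat (a + b) (leaf_height b)) k" "k > 0"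
  shows "(k + 4 - 4 * a) * (k + 2 - 2 * b) = 9 * a * b"
proof -
  let ?n = "a + b" and ?h = "leaf_height b"
  let ?A = "height_mat ?n ?h"
  obtain x where x: "x \<in> carrier_vec ?n" "x \<noteq> 0\<^sub>v ?n" "?A *\<^sub>v x = k \<cdot>\<^sub>v x"
    using assms(1) by (auto simp: eigenvalue_def eigenvector_def height_mat_def)
  define X where "X = (\<Sum>j<?n. x $ j)"
  define Y where "Y = (\<Sum>j<?n. ?h j * x $ j)"
  \<comment> \<open>Row \<open>i\<close> reads \<open>(k + 2 * ?h i) * x $ i = ?h i * X + Y\<close>;
    solving it for heights 1 and 2 gives \<open>s\<close> and \<open>p\<close>. The denominators are
    nonzero since \<open>k > 0\<close>.\<close>
  define s where "s = (X + Y) / (k + 2)"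
  define p where "p = (2 * X + Y) / (k + 4)"
  have val: "x $ i = (if i < b then s else p)" if "i < ?n" for i
  proof -
    have "k * x $ i = ?h i * X + Y - 2 * ?h i * x $ i"
      using height_mat_mult_vec[OF x(1) that, of ?h] x that by (simp add: X_def Y_def)
    then show ?thesis using assms(2)
      by (auto simp: leaf_height_def s_def p_def field_simps)
  qed
  have "X = a * p + b * s" "Y = 2 * a * p + b * s"
    unfolding X_def Y_def using leaf_sums[OF val] by simp_all
  moreover have "(k + 2) * s = X + Y" "(k + 4) * p = 2 * X + Y"
    using assms(2) by (simp_all add: s_def p_def)
  ultimately have eqs: "(k + 4 - 4 * a) * p = 3 * b * s" "(k + 2 - 2 * b) * s = 3 * a * p"
    by (simp_all add: algebra_simps)
  have "p \<noteq> 0 \<or> s \<noteq> 0"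
  proof (rule ccontr)
    assume "\<not> ?thesis"
    then have "x = 0\<^sub>v ?n" using val x(1) by (intro eq_vecI) auto
    with x(2) show False by simp
  qed
  \<comment> \<open>Eliminating either unknown from the system gives the claim multiplied by the
    other; one of them is nonzero and cancels.\<close>
  moreover have "(k + 4 - 4 * a) * (k + 2 - 2 * b) * p = 9 * a * b * p"
  proof -
    have "(k + 4 - 4 * a) * (k + 2 - 2 * b) * p = (k + 2 - 2 * b) * ((k + 4 - 4 * a) * p)"
      by (simp only: ac_simps)
    also have "\<dots> = 3 * b * ((k + 2 - 2 * b) * s)" unfolding eqs(1) by (simp only: ac_simps)
    finally show ?thesis unfolding eqs(2) by (simp add: ac_simps)
  qed
  moreover have "(k + 4 - 4 * a) * (k + 2 - 2 * b) * s = 9 * a * b * s"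
  proof -
    have "(k + 4 - 4 * a) * (k + 2 - 2 * b) * s = (k + 4 - 4 * a) * ((k + 2 - 2 * b) * s)"
      by (simp only: ac_simps)
    also have "\<dots> = 3 * a * ((k + 4 - 4 * a) * p)" unfolding eqs(2) by (simp only: ac_simps)
    finally show ?thesis unfolding eqs(1) by (simp add: ac_simps)
  qed
  ultimately show ?thesis by (metis mult_right_cancel)
qed

lemma quadratic_imp_eigenvalue_height_mat:
  fixes a b :: nat and k :: real
  assumes "a > 0" "b > 0" and root: "(k + 4 - 4 * a) * (k + 2 - 2 * b) = 9 * a * b"
  shows "eigenvalue (height_mat (a + b) (leaf_height b)) k"
proof -
  let ?n = "a + b" and ?h = "leaf_height b"
  let ?A = "height_mat ?n ?h"
  \<comment> \<open>These values solve \<open>(k + 4 - 4 * a) * p = 3 * b * s\<close>; the other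
    equation of the system is then \<open>root\<close>.\<close>
  define s where "s = k + 4 - 4 * a"
  define p where "p = 3 * real b"
  define x where "x = vec ?n (\<lambda>i. if i < b then s else p)"
  have x: "x \<in> carrier_vec ?n" and val: "\<And>i. i < ?n \<Longrightarrow> x $ i = (if i < b then s else p)"
    by (simp_all add: x_def)
  \<comment> \<open>Index \<open>b\<close> is the first long leaf.\<close>
  have "x $ b \<noteq> 0" using \<open>a > 0\<close> \<open>b > 0\<close> by (simp add: val p_def)
  then have "x \<noteq> 0\<^sub>v ?n" using \<open>a > 0\<close> by auto
  moreover have "?A *\<^sub>v x = k \<cdot>\<^sub>v x"
  proof (rule eq_vecI)
    fix i assume "i < dim_vec (k \<cdot>\<^sub>v x)"
    then have i: "i < ?n" by (simp add: x_def)
    have "(?A *\<^sub>v x) $ i = ?h i * (a * p + b * s) + (2 * a * p + b * s) - 2 * ?h i * x $ i"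
      using height_mat_mult_vec[OF x i, of ?h] leaf_sums[OF val] by simp
    also have "\<dots> = k * x $ i"
    proof (cases "i < b")
      case True
      then have "?h i = 1" "x $ i = s" using i by (simp_all add: leaf_height_def val)
      moreover have "(k + 2 - 2 * b) * s = 3 * a * p"
        using root by (simp add: s_def p_def algebra_simps)
      ultimately show ?thesis by (simp add: algebra_simps)
    next
      case False
      then have "?h i = 2" "x $ i = p" using i by (simp_all add: leaf_height_def val)
      then show ?thesis by (simp add: s_def p_def algebra_simps)
    qed
    finally show "(?A *\<^sub>v x) $ i = (k \<cdot>\<^sub>v x) $ i" using i x by simp
  qed (simp add: height_mat_def x_def)
  ultimately show ?thesis using x
    by (auto simp: eigenvalue_def eigenvector_def height_mat_def intro!: exI[of _ x])
qed

text \<open>This makes the largest eigenvalue positive, as the derivation of the quadratic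
  requires.\<close>

lemma ex_pos_eigenvalue_height_mat:
  fixes a b :: nat
  assumes "a > 0" "b > 0"
  shows "\<exists>k > 0. eigenvalue (height_mat (a + b) (leaf_height b)) k"
proof -
  \<comment> \<open>The quadratic is \<open>q x = x^2 - 2 * m * x - r\<close>. As
    \<open>r > 0\<close>, its roots have opposite signs.\<close>
  define m :: real where "m = 2 * real a + real b - 3"
  define r :: real where "r = real a * real b + 8 * real a + 8 * real b - 8"
  have "real a \<ge> 1" "real b \<ge> 1" using assms by simp_all
  moreover have "real a * real b \<ge> 0" by simp
  ultimately have r: "r > 0" unfolding r_def by linarith
  define k where "k = m + sqrt (m\<^sup>2 + r)"
  have "\<bar>m\<bar> < sqrt (m\<^sup>2 + r)" using r by (intro real_less_rsqrt) simp
  then have "k > 0" unfolding k_def by linarith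
  moreover have "(k - m)\<^sup>2 = m\<^sup>2 + r" using r by (simp add: k_def)
  then have "(k + 4 - 4 * a) * (k + 2 - 2 * b) = 9 * a * b"
    unfolding m_def r_def by (simp add: power2_eq_square algebra_simps)
  ultimately show ?thesis using quadratic_imp_eigenvalue_height_mat assms by blast
qed

section \<open>Bounding the roots of the quadratic\<close>

lemma quadratic_root_le:
  fixes a b k :: real
  assumes "a \<ge> 1" "b \<ge> 1" and root: "(k + 4 - 4 * a) * (k + 2 - 2 * b) = 9 * a * b"
  defines "n \<equiv> a + b"
  shows "k \<le> (4 + 3 * sqrt 2) / 8 * (2 * (2 * a + b) * (n - 1) / n)"
proof -
  \<comment> \<open>To leading order in \<open>n\<close>, \<open>M\<close> is
    \<open>2 * (n + a)\<close> and \<open>q x\<close> is \<open>x^2 - M * x - a * b\<close> with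
    \<open>a * b\<close> at most \<open>M^2 / 32\<close>. So \<open>c\<close> is the positive root
    of \<open>c^2 = c + 1/32\<close>.\<close>
  define c where "c = (4 + 3 * sqrt 2) / 8"
  define M where "M = 2 * (2 * a + b) * (n - 1) / n"
  define q where "q x = x\<^sup>2 - 2 * (2 * a + b - 3) * x - (a * b + 8 * n - 8)" for x
  have n: "n \<ge> 2" using assms by simp
  have c: "c\<^sup>2 = c + 1 / 32" by (simp add: c_def power2_eq_square field_simps)
  have "4 / 3 \<le> sqrt 2" by (intro real_le_rsqrt) (simp add: power2_eq_square)
  then have c1: "c \<ge> 1" unfolding c_def by simp
  have Mn: "M * n = 2 * (n + a) * (n - 1)" using n by (simp add: M_def n_def)
  \<comment> \<open>\<open>2 * (2 * a + b - 3)\<close> is the sum of the roots of \<open>q\<close>;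
    the aim is that \<open>M\<close> is no smaller.\<close>
  have Md: "(M - 2 * (2 * a + b - 3)) * n = 2 * (2 * n - a)"
    using Mn by (simp add: n_def algebra_simps)
  have M0: "M \<ge> 0" unfolding M_def using assms n by (intro divide_nonneg_nonneg mult_nonneg_nonneg) auto
  have "2 * n - a \<ge> 0" using assms by simp
  then have "(M - 2 * (2 * a + b - 3)) * n \<ge> 0" using Md by simp
  then have Mt: "M - 2 * (2 * a + b - 3) \<ge> 0" using n by (simp add: zero_le_mult_iff)
  have eq: "q (c * M) = M\<^sup>2 / 32 + c * (M * (M - 2 * (2 * a + b - 3))) - (a * b + 8 * n - 8)"
    unfolding q_def power_mult_distrib c by (simp add: power2_eq_square algebra_simps)
  \<comment> \<open>Lowering the factor \<open>c\<close> to 1 removes the square root and leaves a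
    rational inequality in \<open>a\<close> and \<open>b\<close>.\<close>
  have "M * (M - 2 * (2 * a + b - 3)) \<le> c * (M * (M - 2 * (2 * a + b - 3)))"
    using c1 mult_nonneg_nonneg[OF M0 Mt] mult_right_mono[of 1 c] by fastforce
  then have ge: "M\<^sup>2 / 32 + M * (M - 2 * (2 * a + b - 3)) - (a * b + 8 * n - 8) \<le> q (c * M)"
    using eq by simp
  have "n\<^sup>2 * (M\<^sup>2 / 32 + M * (M - 2 * (2 * a + b - 3)) - (a * b + 8 * n - 8)) =
      (M * n)\<^sup>2 / 32 + (M * n) * ((M - 2 * (2 * a + b - 3)) * n) - n\<^sup>2 * (a * b + 8 * n - 8)"
    by (simp add: power2_eq_square algebra_simps)
  \<comment> \<open>By \<open>n - a = b\<close>, all terms but the first collapse to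
    \<open>- a * b * (n - 2)^2\<close>.\<close>
  also have "\<dots> = (n + a)\<^sup>2 * (n - 1)\<^sup>2 / 8 - a * b * (n - 2)\<^sup>2"
    unfolding Mn Md unfolding n_def by (simp add: power2_eq_square field_simps)
  also have "\<dots> \<ge> 0"
  proof -
    have "8 * (a * b) \<le> (n + a)\<^sup>2"
      using zero_le_power2[of "n - 3 * a"] by (simp add: n_def power2_eq_square algebra_simps)
    moreover have "(n - 2)\<^sup>2 \<le> (n - 1)\<^sup>2" using n by (intro power_mono) auto
    ultimately have "8 * (a * b) * (n - 2)\<^sup>2 \<le> (n + a)\<^sup>2 * (n - 1)\<^sup>2" by (intro mult_mono) auto
    then show ?thesis by simp
  qed
  finally have "M\<^sup>2 / 32 + M * (M - 2 * (2 * a + b - 3)) - (a * b + 8 * n - 8) \<ge> 0"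
    using n by (simp add: zero_le_mult_iff)
  with ge have qcM: "q (c * M) \<ge> 0" by linarith
  have qk: "q k = 0" using root by (simp add: q_def n_def power2_eq_square algebra_simps)
  have "M \<le> c * M" using c1 M0 by (simp add: mult_le_cancel_right1)
  show ?thesis
  proof (rule ccontr)
    assume "\<not> ?thesis"
    then have less: "c * M < k" by (simp add: c_def M_def)
    \<comment> \<open>Since \<open>c * M\<close> is at least the sum of the roots and
      \<open>k > c * M >= 0\<close>, the second factor is positive too.\<close>
    have "0 < (k - c * M) * (k + c * M - 2 * (2 * a + b - 3))"
      using less \<open>M \<le> c * M\<close> Mt M0 by (intro mult_pos_pos) auto
    also have "\<dots> = q k - q (c * M)" by (simp add: q_def power2_eq_square algebra_simps)
    finally show False using qk qcM by simp
  qed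
qed

section \<open>Evaluating \<open>TUB\<close>, \<open>TLB\<close> and \<open>TErr\<close>\<close>

lemma terminal_dist_matrix_BFS_dseq:
  assumes "a > 0" "b > 0"
  shows "terminal_dist_matrix (BFS (dseq a b)) = height_mat (a + b) (leaf_height b)"
proof -
  have "{a + 1..2 * a + b} = {a + 1..<a + 1 + (a + b)}" by auto
  then have "sorted_list_of_set {a + 1..2 * a + b} = [a + 1..<a + 1 + (a + b)]"
    by (simp only: sorted_list_of_set_range)
  moreover have "[a + 1..<a + 1 + (a + b)] ! i = a + 1 + i" if "i < a + b" for i
    using that by (intro nth_upt) simp
  ultimately show ?thesis
    unfolding terminal_dist_matrix_def pendent_verts_BFS_dseq[OF assms] height_mat_def Let_def
    using graph_dist_BFS_dseq[OF assms(1)]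
    by (intro cong_mat) (auto simp: spider_height_def leaf_height_def simp del: upt_Suc)
qed

lemma sum_spider_height:
  "(\<Sum>v\<in>{a + 1..2 * a + b}. spider_height (a + b) v) = 2 * real a + real b"
proof -
  have "(\<Sum>v\<in>{a + 1..2 * a + b}. spider_height (a + b) v) =
      (\<Sum>i<a + b. if i < b then 1 else 2)"
    by (rule sum.reindex_bij_witness[of _ "\<lambda>i. a + 1 + i" "\<lambda>v. v - (a + 1)"])
      (auto simp: spider_height_def)
  then show ?thesis by (simp add: sum_leaf_split)
qed

lemma TWI_BFS_dseq:
  assumes "a > 0" "b > 0"
  shows "TWI (BFS (dseq a b)) = (2 * real a + real b) * (real (a + b) - 1)"
proof -
  let ?W = "{a + 1..2 * a + b}" and ?h = "spider_height (a + b)"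
  let ?t = "2 * real a + real b"
  \<comment> \<open>Here \<open>?t\<close> is the total height of the leaves; \<open>u\<close>
    itself contributes 0 instead of \<open>2 * ?h u\<close>.\<close>
  have row: "(\<Sum>v\<in>?W. graph_dist (BFS (dseq a b)) u v) = (real (a + b) - 2) * ?h u + ?t"
    if u: "u \<in> ?W" for u
  proof -
    have "(\<Sum>v\<in>?W. graph_dist (BFS (dseq a b)) u v) =
        (\<Sum>v\<in>?W. ?h u + ?h v - (if u = v then 2 * ?h u else 0))"
      using u by (intro sum.cong) (auto simp: graph_dist_BFS_dseq[OF assms(1)])
    also have "\<dots> = real (a + b) * ?h u + ?t - 2 * ?h u"
      using u by (simp add: sum_subtractf sum.distrib sum_spider_height[simplified])
    finally show ?thesis by (simp add: algebra_simps)
  qed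
  have "TWI (BFS (dseq a b)) = 1 / 2 * (\<Sum>u\<in>?W. (real (a + b) - 2) * ?h u + ?t)"
    unfolding TWI_def pendent_verts_BFS_dseq[OF assms] using row by simp
  also have "\<dots> = 1 / 2 * ((real (a + b) - 2) * ?t + real (a + b) * ?t)"
    unfolding sum.distrib sum_distrib_left[symmetric] sum_spider_height
    by (simp add: algebra_simps)
  also have "\<dots> = ?t * (real (a + b) - 1)"
    by (simp add: algebra_simps)
  finally show ?thesis .
qed

lemma TLB_dseq:
  assumes "a > 0" "b > 0"
  shows "TLB (dseq a b) = 2 * (2 * real a + real b) * (real (a + b) - 1) / real (a + b)"
proof -
  have "count_list (replicate m x) y = (if x = y then m else 0)" for m and x y :: nat
    by (induction m) auto
  \<comment> \<open>The last entry \<open>a + b\<close> is at least 2 and is not counted.\<close>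
  then have "count_list (dseq a b) 1 = a + b"
    using assms by (auto simp: dseq_def)
  then show ?thesis by (simp add: TLB_def TWI_BFS_dseq[OF assms])
qed

text \<open>The maximum of the finite nonempty spectrum is itself an eigenvalue. Positivity comes
  first, so that it is a root of the quadratic.\<close>

lemma TUB_dseq_bounds:
  assumes "a > 0" "b > 0"
  shows "TUB (dseq a b) > 0" "TUB (dseq a b) \<le> (4 + 3 * sqrt 2) / 8 * TLB (dseq a b)"
proof -
  let ?A = "height_mat (a + b) (leaf_height b)"
  have fin: "finite (spectrum ?A)"
    by (rule card_finite_spectrum[of _ "a + b"]) (simp add: height_mat_def)
  have TUB: "TUB (dseq a b) = Max (spectrum ?A)"
    by (simp add: TUB_def TDSR_def terminal_dist_matrix_BFS_dseq[OF assms])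
  obtain k where k: "k > 0" "k \<in> spectrum ?A"
    using ex_pos_eigenvalue_height_mat[OF assms] by (auto simp: spectrum_def)
  then show pos: "TUB (dseq a b) > 0"
    unfolding TUB using Max_ge[OF fin k(2)] by linarith
  have "TUB (dseq a b) \<in> spectrum ?A"
    unfolding TUB using fin k by (intro Max_in) auto
  then have "(TUB (dseq a b) + 4 - 4 * real a) * (TUB (dseq a b) + 2 - 2 * real b) = 9 * real a * real b"
    using eigenvalue_height_mat_quadratic[OF _ pos] by (simp add: spectrum_def)
  then show "TUB (dseq a b) \<le> (4 + 3 * sqrt 2) / 8 * TLB (dseq a b)"
    using quadratic_root_le[of "real a" "real b"] assms by (simp add: TLB_dseq)
qed

text \<open>With \<open>c = (4 + 3 * sqrt 2) / 8\<close>, the error \<open>1 - TLB / TUB\<close> is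
  at most \<open>1 - 1 / c\<close>, which is the stated constant.\<close>

lemma TErr_dseq_le:
  assumes "a > 0" "b > 0"
  shows "TErr (dseq a b) \<le> (3 * sqrt 2 - 4) / (3 * sqrt 2 + 4)"
proof -
  note bounds = TUB_dseq_bounds[OF assms]
  have c: "0 < 3 * sqrt 2 + 4" by (simp add: add_pos_pos)
  have "8 * TUB (dseq a b) \<le> (3 * sqrt 2 + 4) * TLB (dseq a b)"
    using bounds(2) by (simp add: field_simps)
  then have "(TUB (dseq a b) - TLB (dseq a b)) * (3 * sqrt 2 + 4) \<le> (3 * sqrt 2 - 4) * TUB (dseq a b)"
    by (simp add: algebra_simps)
  then show ?thesis unfolding TErr_def using bounds(1) c by (simp add: divide_le_eq le_divide_eq mult.commute)
qed

theorem theorem3: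
  assumes "\<forall>d. sorted d \<and> generates_tree d \<longrightarrow>
             (\<exists>a b. a > 0 \<and> b > 0 \<and> TErr d \<le> TErr (dseq a b))"
  shows "(\<forall>d. sorted d \<and> generates_tree d \<longrightarrow>
             TErr d \<le> (3 * sqrt 2 - 4) / (3 * sqrt 2 + 4)) \<and>
         (3 * sqrt 2 - 4) / (3 * sqrt 2 + 4) < (0.03 :: real)"
proof
  show "\<forall>d. sorted d \<and> generates_tree d \<longrightarrow> TErr d \<le> (3 * sqrt 2 - 4) / (3 * sqrt 2 + 4)"
    using assms TErr_dseq_le by (meson order_trans)
  \<comment> \<open>The final inequality amounts to \<open>sqrt 2 < 412 / 291\<close>, about 1.4158;
    1.4155 lies in between.\<close>
  have "sqrt 2 < 1.4155" by (rule real_less_lsqrt) (simp_all add: power2_eq_square)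
  moreover have "0 < 3 * sqrt 2 + 4" by (simp add: add_pos_pos)
  ultimately show "(3 * sqrt 2 - 4) / (3 * sqrt 2 + 4) < (0.03 :: real)"
    by (simp add: divide_less_eq)
qed

end
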